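(* Let $A$ be an associative algebra, $M$ an $A$-bimodule, $H$ a Hochschild $2$-cocycle of $A$ with coefficients in $M$, and $T:M\to A$ an $H$-twisted Rota-Baxter operator. Let $(M,* )$ be the associative algebra with product $u*v=u\cdot T(v)+T(u)\cdot v+H(Tu,Tv)$. The maps $l_T:M\otimes A\to A$ and $r_T:A\otimes M\to A$ given by $$l_T(u,a)=T(u)a-T(u\cdot a+H(Tu,a)),\qquad r_T(a,u)=aT(u)-T(a\cdot u+H(a,Tu)),\qquad u\in M,\ a\in A,$$ define an $(M,* )$-bimodule structure on $A$ (with left action $l_T$ and right action $r_T$).
   Context: All vector spaces, linear maps and tensor products are over a field $\mathbb K$ of characteristic $0$. An $A$-bimodule is a vector space $M$ with bilinear left and right actions $(a,u)\mapsto a\cdot u$, $(u,a)\mapsto u\cdot a$ satisfying $(ab)\cdot u=a\cdot(b\cdot u)$, $(a\cdot u)\cdot b=a\cdot(u\cdot b)$, $(u\cdot a)\cdot b=u\cdot(ab)$. A Hochschild $2$-cocycle is a bilinear map $H:A^{\otimes 2}\to M$ with $a\cdot H(b,c)-H(ab,c)+H(a,bc)-H(a,b)\cdot c=0$ for all $a,b,c\in A$. A linear map $T:M\to A$ is an $H$-twisted Rota-Baxter operator if $T(u)T(v)=T(u\cdot T(v)+T(u)\cdot v+H(Tu,Tv))$ for all $u,v\in M$. In that case the product $*$ on $M$ is associative (a known result of Uchino). *)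

theory Defs
  imports Main HOL.Vector_Spaces
begin

text \<open>
  A linear map out of a tensor product \<open>V \<otimes> W\<close> is represented by the corresponding curried
  bilinear map. Algebras are not required to be unital, and hence bimodules carry no unit axiom.
\<close>

definition bilinear_map ::
    "('k::field \<Rightarrow> 'u::ab_group_add \<Rightarrow> 'u) \<Rightarrow> ('k \<Rightarrow> 'v::ab_group_add \<Rightarrow> 'v) \<Rightarrow>
     ('k \<Rightarrow> 'w::ab_group_add \<Rightarrow> 'w) \<Rightarrow> ('u \<Rightarrow> 'v \<Rightarrow> 'w) \<Rightarrow> bool" where
  "bilinear_map s1 s2 s3 f \<longleftrightarrow>
     (\<forall>x. Vector_Spaces.linear s2 s3 (\<lambda>y. f x y)) \<and>
     (\<forall>y. Vector_Spaces.linear s1 s3 (\<lambda>x. f x y))"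

locale assoc_algebra =
  A: vector_space scaleA
  for scaleA :: "'k::field \<Rightarrow> 'a::ab_group_add \<Rightarrow> 'a" +
  fixes mult :: "'a \<Rightarrow> 'a \<Rightarrow> 'a"
  assumes mult_bilinear: "bilinear_map scaleA scaleA scaleA mult"
    and mult_assoc: "mult (mult a b) c = mult a (mult b c)"

locale bimodule =
  assoc_algebra scaleA mult + M: vector_space scaleM
  for scaleA :: "'k::field \<Rightarrow> 'a::ab_group_add \<Rightarrow> 'a"
    and mult :: "'a \<Rightarrow> 'a \<Rightarrow> 'a"
    and scaleM :: "'k \<Rightarrow> 'm::ab_group_add \<Rightarrow> 'm" +
  fixes lact :: "'a \<Rightarrow> 'm \<Rightarrow> 'm"
    and ract :: "'m \<Rightarrow> 'a \<Rightarrow> 'm"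
  assumes lact_bilinear: "bilinear_map scaleA scaleM scaleM lact"
    and ract_bilinear: "bilinear_map scaleM scaleA scaleM ract"
    and lact_mult: "lact (mult a b) u = lact a (lact b u)"
    and lact_ract: "ract (lact a u) b = lact a (ract u b)"
    and ract_mult: "ract (ract u a) b = ract u (mult a b)"

locale hochschild_2_cocycle =
  bimodule scaleA mult scaleM lact ract
  for scaleA :: "'k::field \<Rightarrow> 'a::ab_group_add \<Rightarrow> 'a"
    and mult :: "'a \<Rightarrow> 'a \<Rightarrow> 'a"
    and scaleM :: "'k \<Rightarrow> 'm::ab_group_add \<Rightarrow> 'm"
    and lact :: "'a \<Rightarrow> 'm \<Rightarrow> 'm"
    and ract :: "'m \<Rightarrow> 'a \<Rightarrow> 'm" +
  fixes H :: "'a \<Rightarrow> 'a \<Rightarrow> 'm"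
  assumes H_bilinear: "bilinear_map scaleA scaleA scaleM H"
    and H_cocycle: "lact a (H b c) - H (mult a b) c + H a (mult b c) - ract (H a b) c = 0"

definition twisted_product ::
    "('a \<Rightarrow> 'm \<Rightarrow> 'm) \<Rightarrow> ('m \<Rightarrow> 'a \<Rightarrow> 'm) \<Rightarrow> ('a \<Rightarrow> 'a \<Rightarrow> 'm) \<Rightarrow> ('m \<Rightarrow> 'a) \<Rightarrow>
     'm::ab_group_add \<Rightarrow> 'm \<Rightarrow> 'm" where
  "twisted_product lact ract H T u v = ract u (T v) + lact (T u) v + H (T u) (T v)"

locale twisted_rota_baxter_operator =
  hochschild_2_cocycle scaleA mult scaleM lact ract H
  for scaleA :: "'k::field \<Rightarrow> 'a::ab_group_add \<Rightarrow> 'a"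
    and mult :: "'a \<Rightarrow> 'a \<Rightarrow> 'a"
    and scaleM :: "'k \<Rightarrow> 'm::ab_group_add \<Rightarrow> 'm"
    and lact :: "'a \<Rightarrow> 'm \<Rightarrow> 'm"
    and ract :: "'m \<Rightarrow> 'a \<Rightarrow> 'm"
    and H :: "'a \<Rightarrow> 'a \<Rightarrow> 'm" +
  fixes T :: "'m \<Rightarrow> 'a"
  assumes T_linear: "Vector_Spaces.linear scaleM scaleA T"
    and T_rota_baxter: "mult (T u) (T v) = T (ract u (T v) + lact (T u) v + H (T u) (T v))"

definition left_action_T ::
    "('a::ab_group_add \<Rightarrow> 'a \<Rightarrow> 'a) \<Rightarrow> ('m \<Rightarrow> 'a \<Rightarrow> 'm) \<Rightarrow> ('a \<Rightarrow> 'a \<Rightarrow> 'm) \<Rightarrow> ('m \<Rightarrow> 'a) \<Rightarrow>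
     'm::ab_group_add \<Rightarrow> 'a \<Rightarrow> 'a" where
  "left_action_T mult ract H T u a = mult (T u) a - T (ract u a + H (T u) a)"

definition right_action_T ::
    "('a::ab_group_add \<Rightarrow> 'a \<Rightarrow> 'a) \<Rightarrow> ('a \<Rightarrow> 'm \<Rightarrow> 'm) \<Rightarrow> ('a \<Rightarrow> 'a \<Rightarrow> 'm) \<Rightarrow> ('m \<Rightarrow> 'a) \<Rightarrow>
     'a \<Rightarrow> 'm::ab_group_add \<Rightarrow> 'a" where
  "right_action_T mult lact H T a u = mult a (T u) - T (lact a u + H a (T u))"

end

theory Submission
  imports Defs
begin

text \<open>On the sum of \<open>A\<close> and \<open>M\<close> take the product (a,u)(b,v) = (ab,
  a.v + u.b + H(a,b)), associative by the cocycle identity. The twisted Rota-Baxter identity says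
  that the graph of \<open>T\<close> is a subalgebra; it is a copy of \<open>M\<close> with the
  product \<star>. The quotient of the sum by the graph is therefore a bimodule over it, and (a,u)
  \<mapsto> a - T u identifies this quotient with \<open>A\<close>; the induced actions are exactly
  \<open>left_T\<close> and \<open>right_T\<close>. The proof below checks this by direct
  computation: \<open>T_twisted_product\<close> and \<open>T_H\<close> encode closure of the graph,
  \<open>cocycle\<close> encodes associativity of the sum.\<close>

lemma bilinear_map_linear:
  assumes "bilinear_map s1 s2 s3 f"
  shows "Vector_Spaces.linear s2 s3 (f x)" and "Vector_Spaces.linear s1 s3 (\<lambda>x. f x y)"
  using assms by (simp_all add: bilinear_map_def)

lemma linear_add_diff:
  assumes "Vector_Spaces.linear s1 s2 f"
  shows "f (x + y) = f x + f y" and "f (x - y) = f x - f y"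
proof -
  interpret Vector_Spaces.linear s1 s2 f by fact
  show "f (x + y) = f x + f y" and "f (x - y) = f x - f y" by (fact add, fact diff)
qed

lemmas bilinear_map_add_diff =
  linear_add_diff [OF bilinear_map_linear(1)] linear_add_diff [OF bilinear_map_linear(2)]

lemma linear_fun_add_diff:
  assumes "Vector_Spaces.linear s1 s2 f" and "Vector_Spaces.linear s1 s2 g"
  shows "Vector_Spaces.linear s1 s2 (\<lambda>x. f x + g x)"
    and "Vector_Spaces.linear s1 s2 (\<lambda>x. f x - g x)"
proof -
  interpret f: Vector_Spaces.linear s1 s2 f by fact
  interpret vector_space_pair s1 s2 ..
  show "Vector_Spaces.linear s1 s2 (\<lambda>x. f x + g x)"
    and "Vector_Spaces.linear s1 s2 (\<lambda>x. f x - g x)"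
    using assms by (rule linear_compose_add, rule linear_compose_sub)
qed

lemma bilinear_map_fun_add_diff:
  assumes "bilinear_map s1 s2 s3 f" and "bilinear_map s1 s2 s3 g"
  shows "bilinear_map s1 s2 s3 (\<lambda>x y. f x y + g x y)"
    and "bilinear_map s1 s2 s3 (\<lambda>x y. f x y - g x y)"
  using assms by (simp_all add: bilinear_map_def linear_fun_add_diff)

text \<open>The product and both actions are sums and differences of bilinear maps composed with
  \<open>T\<close> inside or outside, so these closure rules yield their bilinearity.\<close>

lemma bilinear_map_compose:
  assumes "bilinear_map s1 s2 s3 f"
  shows bilinear_map_compose_left:
      "Vector_Spaces.linear s s1 g \<Longrightarrow> bilinear_map s s2 s3 (\<lambda>x y. f (g x) y)"
    and bilinear_map_compose_right:
      "Vector_Spaces.linear s' s2 g' \<Longrightarrow> bilinear_map s1 s' s3 (\<lambda>x y. f x (g' y))"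
    and linear_compose_bilinear_map:
      "Vector_Spaces.linear s3 t h \<Longrightarrow> bilinear_map s1 s2 t (\<lambda>x y. h (f x y))"
proof -
  note compose = Vector_Spaces.linear_compose [unfolded o_def]
  show "bilinear_map s s2 s3 (\<lambda>x y. f (g x) y)" if "Vector_Spaces.linear s s1 g"
    using assms compose [OF that bilinear_map_linear(2) [OF assms]] by (simp add: bilinear_map_def)
  show "bilinear_map s1 s' s3 (\<lambda>x y. f x (g' y))" if "Vector_Spaces.linear s' s2 g'"
    using assms compose [OF that bilinear_map_linear(1) [OF assms]] by (simp add: bilinear_map_def)
  show "bilinear_map s1 s2 t (\<lambda>x y. h (f x y))" if "Vector_Spaces.linear s3 t h"
    using compose [OF bilinear_map_linear(1) [OF assms] that]
      compose [OF bilinear_map_linear(2) [OF assms] that]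
    by (simp add: bilinear_map_def)
qed

context twisted_rota_baxter_operator
begin

abbreviation prod_M (infixl "\<star>" 70) where "u \<star> v \<equiv> twisted_product lact ract H T u v"
abbreviation left_T where "left_T \<equiv> left_action_T mult ract H T"
abbreviation right_T where "right_T \<equiv> right_action_T mult lact H T"

lemmas additive =
  linear_add_diff [OF T_linear]
  bilinear_map_add_diff [OF mult_bilinear]
  bilinear_map_add_diff [OF lact_bilinear]
  bilinear_map_add_diff [OF ract_bilinear]
  bilinear_map_add_diff [OF H_bilinear]

lemmas action_defs = twisted_product_def left_action_T_def right_action_T_def

text \<open>Oriented so that normal forms contain no left action on a value of
  \<open>H\<close>.\<close>

lemma cocycle: "lact a (H b c) = H (mult a b) c - H a (mult b c) + ract (H a b) c"
  using H_cocycle [of a b c] by (simp add: algebra_simps)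

text \<open>The Rota-Baxter identity read as: \<open>T\<close> is an algebra homomorphism from
  \<open>M\<close> with \<star> to \<open>A\<close>.\<close>

lemma T_twisted_product: "T (u \<star> v) = mult (T u) (T v)"
  by (simp add: twisted_product_def T_rota_baxter)

text \<open>
  Rewriting with this orientation and with the cocycle identity in the form above is confluent
  enough that the simplifier decides each bimodule identity once everything is expanded additively.
\<close>
lemma T_H: "T (H (T u) (T v)) = mult (T u) (T v) - T (ract u (T v)) - T (lact (T u) v)"
  by (simp add: T_rota_baxter additive)

lemma twisted_product_bilinear: "bilinear_map scaleM scaleM scaleM (\<star>)"
  unfolding twisted_product_def
  by (intro bilinear_map_fun_add_diff(1)
      bilinear_map_compose_left [OF lact_bilinear] bilinear_map_compose_right [OF ract_bilinear]
      bilinear_map_compose_left [OF bilinear_map_compose_right [OF H_bilinear]] T_linear)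

lemma left_T_bilinear: "bilinear_map scaleM scaleA scaleA left_T"
  unfolding left_action_T_def
  by (intro bilinear_map_fun_add_diff linear_compose_bilinear_map [OF _ T_linear] ract_bilinear
      bilinear_map_compose_left [OF mult_bilinear] bilinear_map_compose_left [OF H_bilinear]
      T_linear)

lemma right_T_bilinear: "bilinear_map scaleA scaleM scaleA right_T"
  unfolding right_action_T_def
  by (intro bilinear_map_fun_add_diff linear_compose_bilinear_map [OF _ T_linear] lact_bilinear
      bilinear_map_compose_right [OF mult_bilinear] bilinear_map_compose_right [OF H_bilinear]
      T_linear)

text \<open>Uchino's result, needed because the locale \<open>bimodule\<close> includes
  associativity of the acting algebra.\<close>

lemma twisted_product_assoc: "u \<star> v \<star> w = u \<star> (v \<star> w)"
proof -
  \<comment> \<open>Only the outer product is unfolded, so that \<open>T (u \<star> v)\<close> can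
    still contract to a product in \<open>A\<close>.\<close>
  have "u \<star> v \<star> w =
      ract (u \<star> v) (T w) + lact (mult (T u) (T v)) w + H (mult (T u) (T v)) (T w)"
    by (simp add: twisted_product_def [of _ _ _ _ "u \<star> v"] T_twisted_product)
  \<comment> \<open>The bimodule axioms match all terms except those with \<open>H\<close>; these
    agree by the cocycle identity at \<open>T u\<close>, \<open>T v\<close>,
    \<open>T w\<close>.\<close>
  also have "\<dots> =
      ract u (mult (T v) (T w)) + lact (T u) (v \<star> w) + H (T u) (mult (T v) (T w))"
    by (simp add: twisted_product_def additive cocycle lact_mult lact_ract ract_mult)
  also have "\<dots> = u \<star> (v \<star> w)"
    by (simp add: twisted_product_def [of _ _ _ _ _ "v \<star> w"] T_twisted_product)
  finally show ?thesis .
qed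

text \<open>Put w = v.a + H(Tv,a). Expanding T(u) T(w) by Rota-Baxter cancels the terms in which
  T(w) enters \<open>ract\<close> or \<open>H\<close>, leaving -T(Tu.w); the cocycle identity at
  \<open>T u\<close>, \<open>T v\<close>, \<open>a\<close> then closes the gap.\<close>

lemma left_T_mult: "left_T (u \<star> v) a = left_T u (left_T v a)"
proof -
  have "left_T (u \<star> v) a =
      mult (mult (T u) (T v)) a - T (ract (u \<star> v) a + H (mult (T u) (T v)) a)"
    by (simp add: left_action_T_def T_twisted_product)
  then show ?thesis
    by (simp add: action_defs additive cocycle lact_mult lact_ract ract_mult mult_assoc T_H)
qed

text \<open>The same cancellation on each side, with the cocycle identity at \<open>T u\<close>,
  \<open>a\<close>, \<open>T v\<close>.\<close>

lemma left_T_right_T: "right_T (left_T u a) v = left_T u (right_T a v)"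
  by (simp add: action_defs additive cocycle lact_mult lact_ract ract_mult mult_assoc T_H)

text \<open>Mirror image of \<open>left_T_mult\<close>, with the cocycle identity at
  \<open>a\<close>, \<open>T u\<close>, \<open>T v\<close>.\<close>

lemma right_T_mult: "right_T (right_T a u) v = right_T a (u \<star> v)"
proof -
  have "right_T a (u \<star> v) =
      mult a (mult (T u) (T v)) - T (lact a (u \<star> v) + H a (mult (T u) (T v)))"
    by (simp add: right_action_T_def T_twisted_product)
  then show ?thesis
    by (simp add: action_defs additive cocycle lact_mult lact_ract ract_mult mult_assoc T_H)
qed

lemma bimodule_T: "bimodule scaleM (\<star>) scaleA left_T right_T"
  by unfold_locales
    (simp_all add: twisted_product_bilinear left_T_bilinear right_T_bilinear
      twisted_product_assoc left_T_mult left_T_right_T right_T_mult)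

end

theorem proposition3p3:
  fixes scaleA :: "'k::field_char_0 \<Rightarrow> 'a::ab_group_add \<Rightarrow> 'a"
    and scaleM :: "'k \<Rightarrow> 'm::ab_group_add \<Rightarrow> 'm"
    and mult :: "'a \<Rightarrow> 'a \<Rightarrow> 'a"
    and lact :: "'a \<Rightarrow> 'm \<Rightarrow> 'm"
    and ract :: "'m \<Rightarrow> 'a \<Rightarrow> 'm"
    and H :: "'a \<Rightarrow> 'a \<Rightarrow> 'm"
    and T :: "'m \<Rightarrow> 'a"
  assumes "assoc_algebra scaleA mult"
    and "bimodule scaleA mult scaleM lact ract"
    and "hochschild_2_cocycle scaleA mult scaleM lact ract H"
    and "twisted_rota_baxter_operator scaleA mult scaleM lact ract H T"
  shows "bimodule scaleM (twisted_product lact ract H T) scaleA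
           (left_action_T mult ract H T) (right_action_T mult lact H T)"
  using assms(4) by (rule twisted_rota_baxter_operator.bimodule_T)

end
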